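(* Let $\mathcal{F}$ be a continuous-time, uncertain, piecewise linear dynamical system on $\mathbb{R}^d$ with modes $Q$, regions $(H_q)_{q\in Q}$ and matrices $(A_q)_{q\in Q}$. Let $\epsilon\ge1$, $\theta>0$, $\delta>0$, $\bar r=\min\{\frac1\epsilon,\frac{\theta\delta}{2+\theta a_{\max}}\}$ and $\mathbb{B}^*=\{c\in\mathbb{R}^d:\|c\|_*\le1\}$. Then the learning algorithm described in the context terminates in at most $N$ steps, where $N$ is the maximal cardinality of a set $\{V_k\}_{k=1}^N$ of polyhedral functions that are solutions of the learner problem (for some finite witness sets $\{X_k\}_{k=1}^N$, $X_k\subseteq\mathbb{S}$) and that are not $\bar r$-close to each other. It holds that $N\le 2^{\mathrm{Cov}_*(\bar r/2;\,\mathbb{B}^* )}$.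
   Context: $\|\cdot\|$ is a vector norm on $\mathbb{R}^d$, with unit sphere $\mathbb{S}=\{x:\|x\|=1\}$, dual norm $\|c\|_*=\max\{c^\top x:x\in\mathbb{S}\}$ and induced matrix norm $\|A\|=\max\{\|Ax\|:x\in\mathbb{S}\}$. A continuous-time, uncertain, piecewise linear dynamical system is given by a finite set of modes $Q$ and, for each $q\in Q$, a closed polyhedral conic region $H_q\subseteq\mathbb{R}^d$ and a matrix $A_q\in\mathbb{R}^{d\times d}$. It is identified with the set-valued map $\mathcal{F}(x)=\{A_qx: q\in Q,\ x\in H_q\}$, and $a_{\max}=\max_{q\in Q}\|A_q\|$. A polyhedral function is $V(x)=\max_{c\in\mathcal{V}}c^\top x$ with $\mathcal{V}\subseteq\mathbb{R}^d$ finite and fixed together with $V$; $\mathcal{V}(x)=\{c\in\mathcal{V}:c^\top x=V(x)\}$. Learner problem for a finite set $X$: find a polyhedral function $V$ with set $\mathcal{V}=\{c_x:x\in X\}\subseteq\mathbb{B}^*$ such that for all $x\in X$: $c_x^\top x\ge\frac1\epsilon\|x\|$, and for all $v\in\mathcal{F}(x)$ and $c\in\mathcal{V}$, $c^\top v\le\frac1\theta(c_x^\top x-c^\top x)-\delta\|x\|$. Verifier problem for $V$: find $x\in\mathbb{R}^d\setminus\{0\}$ (a counterexample) such that either $V(x)\le0$, or there are $v\in\mathcal{F}(x)$ and $c\in\mathcal{V}(x)$ with $c^\top v\ge0$. Learning algorithm: start with $X_0=\emptyset$. For $k=0,1,\ldots$: compute a solution $V_k$ of the learner problem for $X_k$ (if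 none exists, stop and output FAIL); compute a solution $x_k$ of the verifier problem for $V_k$ (if none exists, stop and output $V_k$); set $\bar x_k=x_k/\|x_k\|$ and $X_{k+1}=X_k\cup\{\bar x_k\}$. Two polyhedral functions $V_1,V_2$ (with sets $\mathcal{V}_1,\mathcal{V}_2$) are $s$-close, $s\ge0$, if for all $c_1\in\mathcal{V}_1$, $\inf_{c_2\in\mathcal{V}_2}\|c_1-c_2\|_*<s$, and for all $c_2\in\mathcal{V}_2$, $\inf_{c_1\in\mathcal{V}_1}\|c_1-c_2\|_*<s$. For $s>0$ and compact $C\subseteq\mathbb{R}^d$, the covering number $\mathrm{Cov}_*(s;C)$ is the smallest cardinality of a set $\hat C\subseteq\mathbb{R}^d$ such that for all $c\in C$ there exists $c'\in\hat C$ with $\|c-c'\|_*\le s$.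
   Formalization: The bound N ≤ 2^Cov(r̄/2; B* ) is false as written (closeness is strict, covering balls are closed); it is proved as N ≤ 2^Cov(s; B* ) for every 0 < s < r̄/2. A step is a pass that computes some V_k; a final pass that only outputs FAIL is not counted. *)

theory Defs
  imports "HOL-Analysis.Analysis"
begin

text \<open>
  The norm is an arbitrary one, given as a function \<open>\<nu>\<close>; the Euclidean \<^const>\<open>norm\<close> of the
  type plays no role. Since the unit sphere of \<open>\<nu>\<close> is nonempty and compact, the suprema below
  are attained.
\<close>

definition is_vector_norm :: "(real^'d \<Rightarrow> real) \<Rightarrow> bool" where
  "is_vector_norm \<nu> \<longleftrightarrow>
     (\<forall>x. 0 \<le> \<nu> x) \<and> (\<forall>x. \<nu> x = 0 \<longleftrightarrow> x = 0) \<and>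
     (\<forall>a x. \<nu> (a *\<^sub>R x) = \<bar>a\<bar> * \<nu> x) \<and> (\<forall>x y. \<nu> (x + y) \<le> \<nu> x + \<nu> y)"

definition unit_sphere :: "(real^'d \<Rightarrow> real) \<Rightarrow> (real^'d) set" where
  "unit_sphere \<nu> = {x. \<nu> x = 1}"

definition dual_norm :: "(real^'d \<Rightarrow> real) \<Rightarrow> real^'d \<Rightarrow> real" where
  "dual_norm \<nu> c = (SUP x\<in>unit_sphere \<nu>. c \<bullet> x)"

definition matrix_norm :: "(real^'d \<Rightarrow> real) \<Rightarrow> real^'d^'d \<Rightarrow> real" where
  "matrix_norm \<nu> A = (SUP x\<in>unit_sphere \<nu>. \<nu> (A *v x))"

definition dual_unit_ball :: "(real^'d \<Rightarrow> real) \<Rightarrow> (real^'d) set" where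
  "dual_unit_ball \<nu> = {c. dual_norm \<nu> c \<le> 1}"


definition pwl_system :: "'q set \<Rightarrow> ('q \<Rightarrow> (real^'d) set) \<Rightarrow> bool" where
  "pwl_system Q H \<longleftrightarrow>
     finite Q \<and> Q \<noteq> {} \<and> (\<forall>q\<in>Q. polyhedron (H q) \<and> cone (H q) \<and> H q \<noteq> {})"

definition pwl_map ::
    "'q set \<Rightarrow> ('q \<Rightarrow> (real^'d) set) \<Rightarrow> ('q \<Rightarrow> real^'d^'d) \<Rightarrow> real^'d \<Rightarrow> (real^'d) set" where
  "pwl_map Q H A x = {A q *v x | q. q \<in> Q \<and> x \<in> H q}"

definition a_max :: "(real^'d \<Rightarrow> real) \<Rightarrow> 'q set \<Rightarrow> ('q \<Rightarrow> real^'d^'d) \<Rightarrow> real" where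
  "a_max \<nu> Q A = Max ((\<lambda>q. matrix_norm \<nu> (A q)) ` Q)"


text \<open>
  A polyhedral function comes with its finite set of vectors, so it is represented by that set.
  The set may be empty (this is what the learner returns for \<open>X = {}\<close>); the values are therefore
  extended reals, and the maximum over the empty set is \<open>- \<infinity>\<close>.
\<close>

definition poly_fun :: "(real^'d) set \<Rightarrow> real^'d \<Rightarrow> ereal" where
  "poly_fun \<V> x = (SUP c\<in>\<V>. ereal (c \<bullet> x))"

definition active :: "(real^'d) set \<Rightarrow> real^'d \<Rightarrow> (real^'d) set" where
  "active \<V> x = {c \<in> \<V>. ereal (c \<bullet> x) = poly_fun \<V> x}"


definition learner_solution ::
    "(real^'d \<Rightarrow> real) \<Rightarrow> (real^'d \<Rightarrow> (real^'d) set) \<Rightarrow> real \<Rightarrow> real \<Rightarrow> real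
      \<Rightarrow> (real^'d) set \<Rightarrow> (real^'d) set \<Rightarrow> bool" where
  "learner_solution \<nu> F \<epsilon> \<theta> \<delta> X \<V> \<longleftrightarrow>
     \<V> \<subseteq> dual_unit_ball \<nu> \<and>
     (\<exists>w. \<V> = w ` X \<and>
       (\<forall>x\<in>X. w x \<bullet> x \<ge> 1 / \<epsilon> * \<nu> x \<and>
         (\<forall>v\<in>F x. \<forall>c\<in>\<V>. c \<bullet> v \<le> 1 / \<theta> * (w x \<bullet> x - c \<bullet> x) - \<delta> * \<nu> x)))"

definition counterexample ::
    "(real^'d \<Rightarrow> (real^'d) set) \<Rightarrow> (real^'d) set \<Rightarrow> real^'d \<Rightarrow> bool" where
  "counterexample F \<V> x \<longleftrightarrow>
     x \<noteq> 0 \<and> (poly_fun \<V> x \<le> 0 \<or> (\<exists>v\<in>F x. \<exists>c\<in>active \<V> x. c \<bullet> v \<ge> 0))"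


text \<open>
  One transition is one pass through the loop. Solutions of the two problems are chosen
  arbitrarily, so the transition relation is nondeterministic. \<open>Running X\<close> is the state at the
  head of the loop with current sample set \<open>X\<close>.
\<close>

datatype 'd alg_state =
    Running "(real^'d) set"
  | Failed
  | Returned "(real^'d) set"

inductive alg_step ::
    "(real^'d \<Rightarrow> real) \<Rightarrow> (real^'d \<Rightarrow> (real^'d) set) \<Rightarrow> real \<Rightarrow> real \<Rightarrow> real
      \<Rightarrow> 'd alg_state \<Rightarrow> 'd alg_state \<Rightarrow> bool"
  for \<nu> F \<epsilon> \<theta> \<delta> where
  fail: "(\<nexists>\<V>. learner_solution \<nu> F \<epsilon> \<theta> \<delta> X \<V>)
      \<Longrightarrow> alg_step \<nu> F \<epsilon> \<theta> \<delta> (Running X) Failed"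
| return: "learner_solution \<nu> F \<epsilon> \<theta> \<delta> X \<V> \<Longrightarrow> (\<nexists>x. counterexample F \<V> x)
      \<Longrightarrow> alg_step \<nu> F \<epsilon> \<theta> \<delta> (Running X) (Returned \<V>)"
| refine: "learner_solution \<nu> F \<epsilon> \<theta> \<delta> X \<V> \<Longrightarrow> counterexample F \<V> x
      \<Longrightarrow> alg_step \<nu> F \<epsilon> \<theta> \<delta> (Running X) (Running (X \<union> {x /\<^sub>R \<nu> x}))"

text \<open>
  A step is a pass in which the learner produces some \<open>V\<^sub>k\<close>. The pass that merely detects that the
  learner problem is infeasible and stops with FAIL is not a step; if it were, the bound would be
  off by one (for the system \<open>F x = {x}\<close> on the real line, only the empty polyhedral function is
  ever a learner solution, and FAIL is detected in the pass after it).
  Since \<open>Failed\<close> and \<open>Returned\<close> have no successor and every \<open>Running X\<close> has one, the bound below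
  entails termination of all executions.
\<close>

definition terminates_within ::
    "(real^'d \<Rightarrow> real) \<Rightarrow> (real^'d \<Rightarrow> (real^'d) set) \<Rightarrow> real \<Rightarrow> real \<Rightarrow> real \<Rightarrow> nat \<Rightarrow> bool" where
  "terminates_within \<nu> F \<epsilon> \<theta> \<delta> N \<longleftrightarrow>
     (\<forall>n s. (alg_step \<nu> F \<epsilon> \<theta> \<delta> ^^ n) (Running {}) s \<and> s \<noteq> Failed \<longrightarrow> n \<le> N)"


text \<open>The infima are taken in \<^typ>\<open>ereal\<close>, so that an infimum over the empty set is \<open>\<infinity>\<close>.\<close>

definition close :: "(real^'d \<Rightarrow> real) \<Rightarrow> real \<Rightarrow> (real^'d) set \<Rightarrow> (real^'d) set \<Rightarrow> bool" where
  "close \<nu> s \<V>\<^sub>1 \<V>\<^sub>2 \<longleftrightarrow>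
     (\<forall>c\<^sub>1\<in>\<V>\<^sub>1. (INF c\<^sub>2\<in>\<V>\<^sub>2. ereal (dual_norm \<nu> (c\<^sub>1 - c\<^sub>2))) < ereal s) \<and>
     (\<forall>c\<^sub>2\<in>\<V>\<^sub>2. (INF c\<^sub>1\<in>\<V>\<^sub>1. ereal (dual_norm \<nu> (c\<^sub>1 - c\<^sub>2))) < ereal s)"

definition separated_solutions ::
    "(real^'d \<Rightarrow> real) \<Rightarrow> (real^'d \<Rightarrow> (real^'d) set) \<Rightarrow> real \<Rightarrow> real \<Rightarrow> real \<Rightarrow> real
      \<Rightarrow> (real^'d) set set \<Rightarrow> bool" where
  "separated_solutions \<nu> F \<epsilon> \<theta> \<delta> s \<W> \<longleftrightarrow>
     (\<forall>\<V>\<in>\<W>. \<exists>X. finite X \<and> X \<subseteq> unit_sphere \<nu> \<and> learner_solution \<nu> F \<epsilon> \<theta> \<delta> X \<V>) \<and>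
     (\<forall>\<V>\<^sub>1\<in>\<W>. \<forall>\<V>\<^sub>2\<in>\<W>. \<V>\<^sub>1 \<noteq> \<V>\<^sub>2 \<longrightarrow> \<not> close \<nu> s \<V>\<^sub>1 \<V>\<^sub>2)"

definition is_max_card :: "('a set \<Rightarrow> bool) \<Rightarrow> nat \<Rightarrow> bool" where
  "is_max_card P N \<longleftrightarrow>
     (\<exists>W. P W \<and> finite W \<and> card W = N) \<and> (\<forall>W. P W \<longrightarrow> finite W \<and> card W \<le> N)"

text \<open>
  Covering is by closed balls, whereas \<^const>\<open>close\<close> uses a strict inequality. Two sets that hit the
  same balls of radius \<open>s\<close> are thus only \<open>s'\<close>-close for \<open>s' > 2 * s\<close>, so covering numbers bound
  families that are not \<open>r\<close>-close for radii \<open>s < r / 2\<close>. At \<open>s = r / 2\<close> the bound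
  \<open>2 ^ covering_number \<nu> s (dual_unit_ball \<nu>)\<close> fails in general: for the 1-norm on the plane,
  \<open>r = \<epsilon> = 1\<close> and one mode with region \<open>{0}\<close> and zero matrix, the 256 subsets of
  \<open>{-1, 0, 1}\<^sup>2 - {(0, 0)}\<close> are learner solutions, no two of which are 1-close, while four balls
  of radius 1/2 cover the dual unit ball.
\<close>

definition covering_number ::
    "(real^'d \<Rightarrow> real) \<Rightarrow> real \<Rightarrow> (real^'d) set \<Rightarrow> nat" where
  "covering_number \<nu> s C =
     (LEAST n. \<exists>C'. finite C' \<and> card C' = n \<and> (\<forall>c\<in>C. \<exists>c'\<in>C'. dual_norm \<nu> (c - c') \<le> s))"

end

theory Submission
  imports Defs
begin

text \<open>
  The learner's conditions at a sample \<open>x\<close> hold with a margin: the value at \<open>x\<close> is at least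
  \<open>1 / \<epsilon>\<close>, and a vector whose value at \<open>x\<close> is below that of the vector assigned to \<open>x\<close> by a
  gap \<open>g\<close> decreases at rate \<open>\<delta> - g / \<theta>\<close> or faster. A perturbation of the polyhedral
  function by less than \<open>r\<close> in the dual norm changes its value at \<open>x\<close> by less than \<open>r \<le> 1 / \<epsilon>\<close>.
  In the decrease condition it costs less than \<open>2 * r / \<theta> + r * a\<^sub>m\<^sub>a\<^sub>x \<le> \<delta>\<close>: the gap of a vector
  near an active one is below \<open>2 * r\<close>, and a velocity at \<open>x\<close> has norm at most \<open>a\<^sub>m\<^sub>a\<^sub>x\<close>. Hence no
  polyhedral function that is \<open>r\<close>-close to a learner solution has the counterexample \<open>x\<close>
  (\<open>counterexample_not_close\<close>). Every later learner solution therefore fails to be \<open>r\<close>-close to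
  every earlier one, so an execution with \<open>n\<close> steps produces \<open>n\<close> pairwise separated solutions
  (\<open>run_separated\<close>), and \<open>n\<close> is at most the maximal cardinality of a separated family.

  That maximum exists and obeys the covering bound by pigeonhole: given a cover of the dual unit
  ball by closed balls of radius \<open>s < r / 2\<close>, two solutions that meet exactly the same balls are
  \<open>r\<close>-close, so separated solutions are distinguished by the set of balls they meet
  (\<open>separated_card_le\<close>). Finite covers exist because all norms on a finite-dimensional space are
  equivalent.
\<close>

section \<open>Norms and dual norms\<close>

locale vector_norm =
  fixes \<nu> :: "real^'d \<Rightarrow> real"
  assumes is_norm: "is_vector_norm \<nu>"
begin

lemma nonneg: "0 \<le> \<nu> x"
  and eq_0_iff: "\<nu> x = 0 \<longleftrightarrow> x = 0"
  and scale: "\<nu> (a *\<^sub>R x) = \<bar>a\<bar> * \<nu> x"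
  and triangle: "\<nu> (x + y) \<le> \<nu> x + \<nu> y"
  using is_norm by (auto simp: is_vector_norm_def)

lemma zero [simp]: "\<nu> 0 = 0"
  by (simp add: eq_0_iff)

lemma pos: "x \<noteq> 0 \<Longrightarrow> 0 < \<nu> x"
  using nonneg[of x] eq_0_iff[of x] by linarith

lemma minus: "\<nu> (- x) = \<nu> x"
  using scale[of "-1" x] by simp

lemma normalized_in_sphere: "x \<noteq> 0 \<Longrightarrow> x /\<^sub>R \<nu> x \<in> unit_sphere \<nu>"
  using pos[of x] by (simp add: unit_sphere_def scale)

lemma sphere_nonempty: "unit_sphere \<nu> \<noteq> {}"
proof -
  obtain b :: "real^'d" where "b \<in> Basis" using nonempty_Basis by blast
  then have "b \<noteq> 0" by auto
  then show ?thesis using normalized_in_sphere by blast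
qed

lemma sum_le: "finite I \<Longrightarrow> \<nu> (\<Sum>i\<in>I. f i) \<le> (\<Sum>i\<in>I. \<nu> (f i))"
proof (induction I rule: finite_induct)
  case empty
  then show ?case by simp
next
  case (insert i I)
  then show ?case using triangle[of "f i" "\<Sum>i\<in>I. f i"] by simp
qed

lemma le_norm:
  obtains K where "K > 0" and "\<And>x. \<nu> x \<le> K * norm x"
proof
  define K where "K = 1 + (\<Sum>b\<in>(Basis :: (real^'d) set). \<nu> b)"
  show "K > 0" unfolding K_def by (simp add: add_pos_nonneg nonneg sum_nonneg)
  show "\<nu> x \<le> K * norm x" for x
  proof -
    have "\<nu> x = \<nu> (\<Sum>b\<in>Basis. (x \<bullet> b) *\<^sub>R b)" by (simp add: euclidean_representation)
    also have "\<dots> \<le> (\<Sum>b\<in>Basis. \<bar>x \<bullet> b\<bar> * \<nu> b)"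
      using sum_le[of Basis "\<lambda>b. (x \<bullet> b) *\<^sub>R b"] by (simp add: scale)
    also have "\<dots> \<le> (\<Sum>b\<in>Basis. norm x * \<nu> b)"
      by (intro sum_mono mult_right_mono Basis_le_norm nonneg)
    also have "\<dots> \<le> K * norm x"
      by (simp add: K_def sum_distrib_left algebra_simps)
    finally show ?thesis .
  qed
qed

lemma continuous: "continuous_on S \<nu>"
proof -
  obtain K where K: "K > 0" "\<And>x. \<nu> x \<le> K * norm x" using le_norm by blast
  have "\<bar>\<nu> x - \<nu> y\<bar> \<le> K * norm (x - y)" for x y
    using triangle[of "x - y" y] triangle[of "y - x" x] K(2)[of "x - y"] minus[of "x - y"]
    by simp
  then have "K-lipschitz_on S \<nu>"
    using K(1) by (intro lipschitz_onI) (auto simp: dist_norm)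
  then show ?thesis by (rule lipschitz_on_continuous_on)
qed

text \<open>Compactness of the Euclidean sphere enters here: \<open>\<nu>\<close> attains a positive minimum on it.\<close>

lemma norm_le:
  obtains M where "M > 0" and "\<And>x. norm x \<le> M * \<nu> x"
proof -
  have "\<exists>y\<in>sphere 0 1. \<forall>x\<in>sphere 0 1. \<nu> y \<le> \<nu> x"
    by (rule continuous_attains_inf) (auto intro: continuous)
  then obtain y where y: "norm y = 1" "\<And>x. norm x = 1 \<Longrightarrow> \<nu> y \<le> \<nu> x" by auto
  then have m: "\<nu> y > 0" using pos[of y] by fastforce
  have "norm x \<le> 1 / \<nu> y * \<nu> x" for x
  proof (cases "x = 0")
    case False
    then have "\<nu> y \<le> \<nu> (x /\<^sub>R norm x)" by (intro y(2)) simp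
    also have "\<dots> = \<nu> x / norm x" by (simp add: scale divide_inverse mult.commute)
    finally show ?thesis using m False by (simp add: field_simps)
  qed simp
  with m show ?thesis by (intro that[of "1 / \<nu> y"]) auto
qed

abbreviation dual :: "real^'d \<Rightarrow> real" where
  "dual \<equiv> dual_norm \<nu>"

lemma bdd_above_dual: "bdd_above ((\<lambda>x. c \<bullet> x) ` unit_sphere \<nu>)"
proof -
  obtain M where M: "M > 0" "\<And>x. norm x \<le> M * \<nu> x" using norm_le by blast
  have "c \<bullet> x \<le> norm c * M" if "x \<in> unit_sphere \<nu>" for x
  proof -
    have "c \<bullet> x \<le> norm c * norm x" by (rule norm_cauchy_schwarz)
    also have "\<dots> \<le> norm c * M"
      using M(2)[of x] that by (intro mult_left_mono) (auto simp: unit_sphere_def)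
    finally show ?thesis .
  qed
  then show ?thesis by (rule bdd_aboveI2)
qed

lemma inner_le_dual: "c \<bullet> x \<le> dual c * \<nu> x"
proof (cases "x = 0")
  case False
  then have "c \<bullet> (x /\<^sub>R \<nu> x) \<le> dual c"
    unfolding dual_norm_def by (intro cSUP_upper bdd_above_dual normalized_in_sphere)
  then show ?thesis using pos[OF False] by (simp add: field_simps)
qed simp

lemma dual_leI: "(\<And>x. \<nu> x = 1 \<Longrightarrow> c \<bullet> x \<le> a) \<Longrightarrow> dual c \<le> a"
  unfolding dual_norm_def by (rule cSUP_least[OF sphere_nonempty]) (simp add: unit_sphere_def)

lemma dual_zero: "dual 0 = 0"
  using sphere_nonempty by (simp add: dual_norm_def)

lemma dual_minus_commute: "dual (a - b) = dual (b - a)"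
proof -
  have "dual (a - b) \<le> dual (b - a)" for a b
  proof (rule dual_leI)
    fix x assume "\<nu> x = 1"
    then show "(a - b) \<bullet> x \<le> dual (b - a)"
      using inner_le_dual[of "b - a" "- x"] by (simp add: minus inner_diff_left)
  qed
  then show ?thesis by (meson antisym)
qed

lemma dual_diff_triangle: "dual (a - c) \<le> dual (a - b) + dual (b - c)"
proof (rule dual_leI)
  fix x assume "\<nu> x = 1"
  then show "(a - c) \<bullet> x \<le> dual (a - b) + dual (b - c)"
    using inner_le_dual[of "a - b" x] inner_le_dual[of "b - c" x] by (simp add: inner_diff_left)
qed

lemma dual_le_norm:
  obtains M where "M > 0" and "\<And>c. dual c \<le> M * norm c"
proof -
  obtain M where M: "M > 0" "\<And>x. norm x \<le> M * \<nu> x" using norm_le by blast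
  have "dual c \<le> M * norm c" for c
  proof (rule dual_leI)
    fix x assume "\<nu> x = 1"
    then have "norm c * norm x \<le> norm c * M" using M(2)[of x] by (intro mult_left_mono) auto
    then show "c \<bullet> x \<le> M * norm c"
      using norm_cauchy_schwarz[of c x] by (simp add: mult.commute)
  qed
  with M(1) that show ?thesis by blast
qed

text \<open>Testing a vector \<open>c\<close> of the ball against itself gives \<open>\<parallel>c\<parallel>\<^sup>2 \<le> \<nu> c \<le> K * \<parallel>c\<parallel>\<close> in the
  Euclidean norm.\<close>

lemma bounded_dual_unit_ball: "bounded (dual_unit_ball \<nu>)"
proof -
  obtain K where K: "K > 0" "\<And>x. \<nu> x \<le> K * norm x" using le_norm by blast
  have "norm c \<le> K" if "c \<in> dual_unit_ball \<nu>" for c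
  proof -
    have "norm c * norm c = c \<bullet> c" by (simp add: dot_square_norm power2_eq_square)
    also have "\<dots> \<le> dual c * \<nu> c" by (rule inner_le_dual)
    also have "\<dots> \<le> 1 * \<nu> c"
      using that by (intro mult_right_mono nonneg) (simp add: dual_unit_ball_def)
    also have "\<dots> \<le> K * norm c" using K(2) by simp
    finally show ?thesis using K(1) by (cases "c = 0") auto
  qed
  then show ?thesis by (auto simp: bounded_iff)
qed

lemma ex_finite_cover:
  assumes "s > 0"
  shows "\<exists>C'. finite C' \<and> (\<forall>c\<in>dual_unit_ball \<nu>. \<exists>c'\<in>C'. dual (c - c') \<le> s)"
proof -
  obtain M where M: "M > 0" "\<And>c. dual c \<le> M * norm c" using dual_le_norm by blast
  have "compact (closure (dual_unit_ball \<nu>))"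
    using bounded_dual_unit_ball by simp
  moreover have "s / M > 0" using assms M(1) by simp
  ultimately obtain C' where C': "finite C'"
      "closure (dual_unit_ball \<nu>) \<subseteq> (\<Union>x\<in>C'. ball x (s / M))"
    unfolding compact_eq_totally_bounded by blast
  have "\<exists>c'\<in>C'. dual (c - c') \<le> s" if "c \<in> dual_unit_ball \<nu>" for c
  proof -
    have "c \<in> (\<Union>x\<in>C'. ball x (s / M))" using C'(2) that closure_subset by blast
    then obtain c' where "c' \<in> C'" "dist c' c < s / M" by auto
    moreover from this have "M * norm (c - c') \<le> s"
      using M(1) by (simp add: dist_norm norm_minus_commute field_simps)
    ultimately show ?thesis using M(2)[of "c - c'"] by force
  qed
  with C'(1) show ?thesis by blast
qed

lemma covering_number_cover:
  assumes "s > 0"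
  obtains C' where "finite C'" and "card C' = covering_number \<nu> s (dual_unit_ball \<nu>)"
    and "\<And>c. c \<in> dual_unit_ball \<nu> \<Longrightarrow> \<exists>c'\<in>C'. dual (c - c') \<le> s"
proof -
  let ?P = "\<lambda>n. \<exists>C'. finite C' \<and> card C' = n \<and>
    (\<forall>c\<in>dual_unit_ball \<nu>. \<exists>c'\<in>C'. dual (c - c') \<le> s)"
  have "\<exists>n. ?P n" using ex_finite_cover[OF assms] by blast
  then have "?P (covering_number \<nu> s (dual_unit_ball \<nu>))"
    unfolding covering_number_def by (rule LeastI_ex)
  with that show ?thesis by blast
qed

lemma image_le_matrix_norm:
  assumes "\<nu> x = 1"
  shows "\<nu> (A *v x) \<le> matrix_norm \<nu> A"
proof -
  obtain K where K: "K > 0" "\<And>x. \<nu> x \<le> K * norm x" using le_norm by blast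
  obtain M where M: "M > 0" "\<And>x. norm x \<le> M * \<nu> x" using norm_le by blast
  obtain B where B: "B > 0" "\<And>x. norm (A *v x) \<le> B * norm x"
    using linear_bounded_pos[OF matrix_vector_mul_linear[of A]] by blast
  have "\<nu> (A *v x) \<le> K * (B * M)" if "x \<in> unit_sphere \<nu>" for x
  proof -
    have "norm (A *v x) \<le> B * M"
      using B mult_left_mono[of "norm x" M B] M(2)[of x] that
      by (intro order_trans[OF B(2)]) (simp add: unit_sphere_def)
    then have "K * norm (A *v x) \<le> K * (B * M)" using K(1) by (intro mult_left_mono) auto
    then show ?thesis using K(2)[of "A *v x"] by linarith
  qed
  then have "bdd_above ((\<lambda>x. \<nu> (A *v x)) ` unit_sphere \<nu>)" by (rule bdd_aboveI2)
  then show ?thesis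
    unfolding matrix_norm_def using assms by (intro cSUP_upper) (auto simp: unit_sphere_def)
qed

lemma close_iff:
  "close \<nu> s V W \<longleftrightarrow>
     (\<forall>c\<in>V. \<exists>c'\<in>W. dual (c - c') < s) \<and> (\<forall>c'\<in>W. \<exists>c\<in>V. dual (c - c') < s)"
  by (simp add: close_def INF_less_iff)

lemma close_refl: "s > 0 \<Longrightarrow> close \<nu> s V V"
  by (metis close_iff diff_self dual_zero)

lemma close_sym: "close \<nu> s V W \<Longrightarrow> close \<nu> s W V"
  by (simp add: close_iff dual_minus_commute)

end

section \<open>Polyhedral functions and counterexamples\<close>

lemma poly_fun_le_0_iff: "poly_fun V x \<le> 0 \<longleftrightarrow> (\<forall>c\<in>V. c \<bullet> x \<le> 0)"
  by (simp add: poly_fun_def SUP_le_iff)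

lemma mem_active_iff: "c \<in> active V x \<longleftrightarrow> c \<in> V \<and> (\<forall>d\<in>V. d \<bullet> x \<le> c \<bullet> x)"
proof
  assume "c \<in> active V x"
  then have c: "c \<in> V" "ereal (c \<bullet> x) = poly_fun V x" by (auto simp: active_def)
  have "ereal (d \<bullet> x) \<le> ereal (c \<bullet> x)" if "d \<in> V" for d
    unfolding c(2) poly_fun_def using that by (rule SUP_upper)
  with c(1) show "c \<in> V \<and> (\<forall>d\<in>V. d \<bullet> x \<le> c \<bullet> x)" by simp
next
  assume "c \<in> V \<and> (\<forall>d\<in>V. d \<bullet> x \<le> c \<bullet> x)"
  then show "c \<in> active V x"
    by (auto simp: active_def poly_fun_def intro!: antisym SUP_upper SUP_least)
qed

lemma pwl_map_scale:
  assumes "pwl_system Q H" and "a > 0" and "v \<in> pwl_map Q H A x"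
  shows "a *\<^sub>R v \<in> pwl_map Q H A (a *\<^sub>R x)"
proof -
  obtain q where q: "q \<in> Q" "x \<in> H q" "v = A q *v x"
    using assms(3) by (auto simp: pwl_map_def)
  then have "a *\<^sub>R x \<in> H q" using assms(1,2) by (auto simp: pwl_system_def cone_def)
  moreover have "A q *v (a *\<^sub>R x) = a *\<^sub>R v" by (simp add: q(3) matrix_vector_mult_scaleR)
  ultimately show ?thesis using q(1) unfolding pwl_map_def by (metis (mono_tags, lifting) mem_Collect_eq)
qed

text \<open>
  The regions are cones and \<open>F\<close> and \<open>V\<close> are positively homogeneous, so the normalized point that
  the algorithm stores is itself a counterexample.
\<close>

lemma counterexample_scale:
  assumes "pwl_system Q H" and "a > 0" and "counterexample (pwl_map Q H A) V x"
  shows "counterexample (pwl_map Q H A) V (a *\<^sub>R x)"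
proof -
  have x: "x \<noteq> 0" and "poly_fun V x \<le> 0 \<or> (\<exists>v\<in>pwl_map Q H A x. \<exists>c\<in>active V x. c \<bullet> v \<ge> 0)"
    using assms(3) by (auto simp: counterexample_def)
  from this(2) show ?thesis
  proof
    assume "poly_fun V x \<le> 0"
    then have "poly_fun V (a *\<^sub>R x) \<le> 0"
      using assms(2) by (simp add: poly_fun_le_0_iff mult_le_0_iff)
    then show ?thesis using x assms(2) by (simp add: counterexample_def)
  next
    assume "\<exists>v\<in>pwl_map Q H A x. \<exists>c\<in>active V x. c \<bullet> v \<ge> 0"
    then obtain v c where vc: "v \<in> pwl_map Q H A x" "c \<in> active V x" "c \<bullet> v \<ge> 0" by blast
    have "a *\<^sub>R v \<in> pwl_map Q H A (a *\<^sub>R x)" by (rule pwl_map_scale[OF assms(1,2) vc(1)])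
    moreover have "c \<in> active V (a *\<^sub>R x)" using vc(2) assms(2) by (simp add: mem_active_iff)
    moreover have "c \<bullet> (a *\<^sub>R v) \<ge> 0" using vc(3) assms(2) by simp
    moreover have "a *\<^sub>R x \<noteq> 0" using x assms(2) by simp
    ultimately show ?thesis unfolding counterexample_def by blast
  qed
qed

section \<open>Separation along an execution\<close>

locale learning_problem = vector_norm \<nu>
  for \<nu> :: "real^'d \<Rightarrow> real" +
  fixes Q :: "'q set" and H :: "'q \<Rightarrow> (real^'d) set" and A :: "'q \<Rightarrow> real^'d^'d"
    and \<epsilon> \<theta> \<delta> :: real
  assumes system: "pwl_system Q H"
    and \<epsilon>_pos: "\<epsilon> > 0" and \<theta>_pos: "\<theta> > 0" and \<delta>_pos: "\<delta> > 0"
begin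

abbreviation F :: "real^'d \<Rightarrow> (real^'d) set" where
  "F \<equiv> pwl_map Q H A"

definition radius :: real where
  "radius = min (1 / \<epsilon>) (\<theta> * \<delta> / (2 + \<theta> * a_max \<nu> Q A))"

lemma image_le_a_max:
  assumes "q \<in> Q" and "\<nu> x = 1"
  shows "\<nu> (A q *v x) \<le> a_max \<nu> Q A"
proof -
  have "matrix_norm \<nu> (A q) \<le> a_max \<nu> Q A"
    unfolding a_max_def using assms(1) system by (intro Max_ge) (auto simp: pwl_system_def)
  then show ?thesis using image_le_matrix_norm[OF assms(2), of "A q"] by linarith
qed

lemma a_max_nonneg: "0 \<le> a_max \<nu> Q A"
proof -
  obtain x q where "\<nu> x = 1" "q \<in> Q"
    using sphere_nonempty system by (auto simp: unit_sphere_def pwl_system_def)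
  then show ?thesis using image_le_a_max[of q x] nonneg[of "A q *v x"] by linarith
qed

lemma denominator_pos: "0 < 2 + \<theta> * a_max \<nu> Q A"
  using a_max_nonneg \<theta>_pos by (simp add: add_pos_nonneg)

lemma radius_pos: "0 < radius"
  using denominator_pos \<epsilon>_pos \<theta>_pos \<delta>_pos by (simp add: radius_def)

lemma radius_budget: "2 * radius + \<theta> * (radius * a_max \<nu> Q A) \<le> \<theta> * \<delta>"
proof -
  have "radius \<le> \<theta> * \<delta> / (2 + \<theta> * a_max \<nu> Q A)" by (simp add: radius_def)
  then have "radius * (2 + \<theta> * a_max \<nu> Q A) \<le> \<theta> * \<delta>"
    using denominator_pos by (simp add: pos_le_divide_eq)
  then show ?thesis by (simp add: algebra_simps)
qed

text \<open>
  Each vector of one function has a neighbour in the other. The neighbour \<open>d\<close> of the learner's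
  vector \<open>w x\<close> shows that the value of \<open>V\<close> at \<open>x\<close> is positive; if \<open>c\<close> is active in \<open>V\<close>, its
  neighbour \<open>c'\<close> satisfies \<open>c' \<bullet> x > w x \<bullet> x - 2 * radius\<close>, because \<open>d \<bullet> x \<le> c \<bullet> x\<close>, and so
  the decrease condition makes \<open>c' \<bullet> v\<close>, and with it \<open>c \<bullet> v\<close>, negative.
\<close>

lemma counterexample_not_close:
  assumes ce: "counterexample F V x" and "\<nu> x = 1" and "x \<in> X"
    and sol: "learner_solution \<nu> F \<epsilon> \<theta> \<delta> X W"
  shows "\<not> close \<nu> radius V W"
proof
  assume close: "close \<nu> radius V W"
  obtain w where w: "W = w ` X" and at_samples: "\<forall>x\<in>X. w x \<bullet> x \<ge> 1 / \<epsilon> * \<nu> x \<and>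
      (\<forall>v\<in>F x. \<forall>c\<in>W. c \<bullet> v \<le> 1 / \<theta> * (w x \<bullet> x - c \<bullet> x) - \<delta> * \<nu> x)"
    using sol unfolding learner_solution_def by blast
  have at_least: "w x \<bullet> x \<ge> 1 / \<epsilon>"
    and decrease: "\<And>v c. v \<in> F x \<Longrightarrow> c \<in> W \<Longrightarrow> c \<bullet> v \<le> 1 / \<theta> * (w x \<bullet> x - c \<bullet> x) - \<delta>"
    using bspec[OF at_samples \<open>x \<in> X\<close>] \<open>\<nu> x = 1\<close> by simp_all
  have "w x \<in> W" using w assms(3) by simp
  then obtain d where d: "d \<in> V" "dual (d - w x) < radius"
    using close by (auto simp: close_iff)
  then have d_near: "w x \<bullet> x < d \<bullet> x + radius"
    using inner_le_dual[of "w x - d" x] dual_minus_commute[of "w x" d] assms(2)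
    by (simp add: inner_diff_left)
  have "radius \<le> 1 / \<epsilon>" by (simp add: radius_def)
  then have "d \<bullet> x > 0" using d_near at_least by linarith
  then have "\<not> poly_fun V x \<le> 0" using d(1) by (fastforce simp: poly_fun_le_0_iff)
  then obtain v c where v: "v \<in> F x" and c: "c \<in> active V x" "c \<bullet> v \<ge> 0"
    using ce by (auto simp: counterexample_def)
  obtain q where "q \<in> Q" "v = A q *v x" using v by (auto simp: pwl_map_def)
  then have v_le: "\<nu> v \<le> a_max \<nu> Q A" using image_le_a_max assms(2) by simp
  have "d \<bullet> x \<le> c \<bullet> x" using c(1) d(1) by (simp add: mem_active_iff)
  obtain c' where c': "c' \<in> W" "dual (c - c') < radius"
    using close c(1) by (auto simp: close_iff mem_active_iff)
  have "c \<bullet> x - c' \<bullet> x < radius"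
    using inner_le_dual[of "c - c'" x] c'(2) assms(2) by (simp add: inner_diff_left)
  then have "w x \<bullet> x - c' \<bullet> x < 2 * radius" using d_near \<open>d \<bullet> x \<le> c \<bullet> x\<close> by linarith
  moreover have "\<theta> * (c' \<bullet> v) \<le> w x \<bullet> x - c' \<bullet> x - \<theta> * \<delta>"
    using mult_left_mono[OF decrease[OF v c'(1)], of \<theta>] \<theta>_pos by (simp add: algebra_simps)
  moreover have "- (\<theta> * (radius * a_max \<nu> Q A)) \<le> \<theta> * (c' \<bullet> v)"
  proof -
    have "(c - c') \<bullet> v \<le> dual (c - c') * \<nu> v" by (rule inner_le_dual)
    also have "\<dots> \<le> radius * a_max \<nu> Q A"
      using c'(2) radius_pos v_le by (intro mult_mono nonneg) auto
    finally have "- (radius * a_max \<nu> Q A) \<le> c' \<bullet> v" using c(2) by (simp add: inner_diff_left)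
    then show ?thesis using mult_left_mono[of _ _ \<theta>] \<theta>_pos by fastforce
  qed
  ultimately show False using radius_budget by linarith
qed

text \<open>
  The samples remember a counterexample for each earlier solution, which is what excludes closeness
  of the next one. A pass that returns adds a solution as well, whereas a failing pass does not.
\<close>

lemma run_separated:
  assumes "(alg_step \<nu> F \<epsilon> \<theta> \<delta> ^^ n) (Running {}) st" and "st \<noteq> Failed"
  shows "\<exists>\<W>. separated_solutions \<nu> F \<epsilon> \<theta> \<delta> radius \<W> \<and> finite \<W> \<and> card \<W> = n \<and>
    (\<forall>X. st = Running X \<longrightarrow> finite X \<and> X \<subseteq> unit_sphere \<nu> \<and>
      (\<forall>V\<in>\<W>. \<exists>x\<in>X. counterexample F V x))"
  using assms
proof (induction n arbitrary: st)
  case 0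
  then show ?case by (intro exI[of _ "{}"]) (auto simp: separated_solutions_def)
next
  case (Suc n)
  obtain st' where run: "(alg_step \<nu> F \<epsilon> \<theta> \<delta> ^^ n) (Running {}) st'"
    and step: "alg_step \<nu> F \<epsilon> \<theta> \<delta> st' st"
    using Suc.prems(1) by auto
  have "\<exists>X V. st' = Running X \<and> learner_solution \<nu> F \<epsilon> \<theta> \<delta> X V \<and>
      (\<forall>Y. st = Running Y \<longrightarrow> (\<exists>x. counterexample F V x \<and> Y = X \<union> {x /\<^sub>R \<nu> x}))"
    using step Suc.prems(2) by cases auto
  then obtain X V where st': "st' = Running X" and sol: "learner_solution \<nu> F \<epsilon> \<theta> \<delta> X V"
    and new: "\<And>Y. st = Running Y \<Longrightarrow> \<exists>x. counterexample F V x \<and> Y = X \<union> {x /\<^sub>R \<nu> x}"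
    by blast
  obtain \<W> where W: "separated_solutions \<nu> F \<epsilon> \<theta> \<delta> radius \<W>" "finite \<W>" "card \<W> = n"
    and X: "finite X" "X \<subseteq> unit_sphere \<nu>"
    and ce: "\<And>U. U \<in> \<W> \<Longrightarrow> \<exists>x\<in>X. counterexample F U x"
    using Suc.IH[OF run] st' by auto
  have far: "\<not> close \<nu> radius U V" if "U \<in> \<W>" for U
    using ce[OF that] X(2) counterexample_not_close[OF _ _ _ sol]
    by (auto simp: unit_sphere_def)
  have "V \<notin> \<W>" using far close_refl[OF radius_pos] by blast
  then have "card (insert V \<W>) = Suc n" using W(2,3) by simp
  moreover have "separated_solutions \<nu> F \<epsilon> \<theta> \<delta> radius (insert V \<W>)"
    unfolding separated_solutions_def
  proof (intro conjI ballI impI)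
    fix U assume "U \<in> insert V \<W>"
    then show "\<exists>X. finite X \<and> X \<subseteq> unit_sphere \<nu> \<and> learner_solution \<nu> F \<epsilon> \<theta> \<delta> X U"
      using W(1) sol X by (auto simp: separated_solutions_def)
  next
    fix U U' assume "U \<in> insert V \<W>" "U' \<in> insert V \<W>" "U \<noteq> U'"
    then consider "U \<in> \<W>" "U' \<in> \<W>" | "U \<in> \<W>" "U' = V" | "U = V" "U' \<in> \<W>" by blast
    then show "\<not> close \<nu> radius U U'"
    proof cases
      case 1
      then show ?thesis using W(1) \<open>U \<noteq> U'\<close> by (auto simp: separated_solutions_def)
    next
      case 2
      then show ?thesis using far by blast
    next
      case 3
      then show ?thesis using far close_sym by blast
    qed
  qed
  moreover have "finite Y \<and> Y \<subseteq> unit_sphere \<nu> \<and> (\<forall>U\<in>insert V \<W>. \<exists>x\<in>Y. counterexample F U x)"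
    if "st = Running Y" for Y
  proof -
    obtain x where x: "counterexample F V x" and Y: "Y = X \<union> {x /\<^sub>R \<nu> x}"
      using new[OF \<open>st = Running Y\<close>] by blast
    have "x \<noteq> 0" using x by (simp add: counterexample_def)
    then have "counterexample F V (x /\<^sub>R \<nu> x)" "x /\<^sub>R \<nu> x \<in> unit_sphere \<nu>"
      using counterexample_scale[OF system _ x] pos normalized_in_sphere by auto
    then show ?thesis using X ce by (auto simp: Y)
  qed
  ultimately show ?case using W(2) by (intro exI[of _ "insert V \<W>"]) auto
qed

section \<open>The covering bound\<close>

lemma separated_card_le:
  assumes sep: "separated_solutions \<nu> F \<epsilon> \<theta> \<delta> r \<W>" and s: "0 < s" "s < r / 2"
  shows "finite \<W> \<and> card \<W> \<le> 2 ^ covering_number \<nu> s (dual_unit_ball \<nu>)"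
proof -
  obtain C where C: "finite C" "card C = covering_number \<nu> s (dual_unit_ball \<nu>)"
    and cover: "\<And>c. c \<in> dual_unit_ball \<nu> \<Longrightarrow> \<exists>c'\<in>C. dual (c - c') \<le> s"
    by (rule covering_number_cover[OF s(1)]) blast
  define hit where "hit V = {c' \<in> C. \<exists>c\<in>V. dual (c - c') \<le> s}" for V
  have in_ball: "V \<subseteq> dual_unit_ball \<nu>" if "V \<in> \<W>" for V
    using sep that by (auto simp: separated_solutions_def learner_solution_def)
  have near: "\<exists>d\<in>W. dual (c - d) < r"
    if Vc: "V \<in> \<W>" "c \<in> V" and "hit V = hit W" for V W c
  proof -
    obtain c' where c': "c' \<in> C" "dual (c - c') \<le> s" using cover in_ball Vc by blast
    then have "c' \<in> hit W" using Vc(2) \<open>hit V = hit W\<close> by (auto simp: hit_def)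
    then obtain d where "d \<in> W" "dual (d - c') \<le> s" by (auto simp: hit_def)
    then show ?thesis
      using c'(2) dual_diff_triangle[of c d c'] dual_minus_commute[of d c'] s(2) by force
  qed
  have "inj_on hit \<W>"
  proof (rule inj_onI, rule ccontr)
    fix V W assume VW: "V \<in> \<W>" "W \<in> \<W>" "hit V = hit W" "V \<noteq> W"
    have "\<exists>d\<in>V. dual (d - c) < r" if c: "c \<in> W" for c
      using near[OF VW(2) c VW(3)[symmetric]] dual_minus_commute[of c] by auto
    then have "close \<nu> r V W"
      unfolding close_iff using near[OF VW(1) _ VW(3)] by blast
    then show False using sep VW by (auto simp: separated_solutions_def)
  qed
  moreover have "hit ` \<W> \<subseteq> Pow C" by (auto simp: hit_def)
  ultimately show ?thesis
    using C card_inj_on_le[of hit \<W> "Pow C"] inj_on_finite[of hit \<W> "Pow C"]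
    by (simp add: card_Pow)
qed

end

lemma ex_is_max_card:
  assumes "P {}" and bound: "\<And>W. P W \<Longrightarrow> finite W \<and> card W \<le> B"
  shows "\<exists>N. is_max_card P N"
proof -
  let ?S = "{card W | W. P W}"
  have fin: "finite ?S" using bound by (intro finite_subset[OF _ finite_atMost[of B]]) auto
  moreover have "?S \<noteq> {}" using assms(1) by blast
  ultimately have "Max ?S \<in> ?S" by (rule Max_in)
  then obtain W where "P W" "card W = Max ?S" by auto
  moreover have "card W' \<le> Max ?S" if "P W'" for W' using fin that by (intro Max_ge) auto
  ultimately show ?thesis using bound by (auto simp: is_max_card_def)
qed

theorem theorem30:
  fixes \<nu> :: "real^'d \<Rightarrow> real"
    and Q :: "'q set"
    and H :: "'q \<Rightarrow> (real^'d) set"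
    and A :: "'q \<Rightarrow> real^'d^'d"
    and \<epsilon> \<theta> \<delta> r :: real
  defines "F \<equiv> pwl_map Q H A"
    and "r \<equiv> min (1 / \<epsilon>) (\<theta> * \<delta> / (2 + \<theta> * a_max \<nu> Q A))"
  assumes "is_vector_norm \<nu>"
    and "pwl_system Q H"
    and "\<epsilon> \<ge> 1" and "\<theta> > 0" and "\<delta> > 0"
  shows "\<exists>N. is_max_card (separated_solutions \<nu> F \<epsilon> \<theta> \<delta> r) N \<and>
             terminates_within \<nu> F \<epsilon> \<theta> \<delta> N \<and>
             (\<forall>s. 0 < s \<and> s < r / 2 \<longrightarrow> N \<le> 2 ^ covering_number \<nu> s (dual_unit_ball \<nu>))"
proof -
  interpret learning_problem \<nu> Q H A \<epsilon> \<theta> \<delta>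
    using assms(3-7) by unfold_locales auto
  have r: "r = radius" by (simp add: r_def radius_def)
  let ?P = "separated_solutions \<nu> F \<epsilon> \<theta> \<delta> r"
  have cover: "finite \<W> \<and> card \<W> \<le> 2 ^ covering_number \<nu> s (dual_unit_ball \<nu>)"
    if "?P \<W>" "0 < s" "s < r / 2" for \<W> s
    using separated_card_le that by (simp add: F_def)
  \<comment> \<open>Any admissible covering radius serves to show that the maximum exists.\<close>
  have "\<exists>N. is_max_card ?P N"
    using radius_pos r
    by (intro ex_is_max_card[where B = "2 ^ covering_number \<nu> (r / 4) (dual_unit_ball \<nu>)"] cover)
      (auto simp: separated_solutions_def)
  then obtain N where N: "is_max_card ?P N" by blast
  have "terminates_within \<nu> F \<epsilon> \<theta> \<delta> N"
    unfolding terminates_within_def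
  proof (intro allI impI)
    fix n st assume "(alg_step \<nu> F \<epsilon> \<theta> \<delta> ^^ n) (Running {}) st \<and> st \<noteq> Failed"
    then obtain \<W> where "?P \<W>" "card \<W> = n"
      using run_separated[of n st] by (auto simp: F_def r)
    then show "n \<le> N" using N by (auto simp: is_max_card_def)
  qed
  moreover have "N \<le> 2 ^ covering_number \<nu> s (dual_unit_ball \<nu>)" if "0 < s" "s < r / 2" for s
    using N cover[OF _ that] by (auto simp: is_max_card_def)
  ultimately show ?thesis using N by blast
qed

end
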